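(* For each $k\in[1,n]$ let $S_k$ be a finite subset of $R$, $\psi_k:S_k\to\mathbb{Z}^+$, and $g_k=\prod_{u\in S_k}(x_k-u)^{\psi_k(u)}$. (1) Suppose every $S_k$ satisfies Condition (D) in $R$ and fix $t\in\mathbb{N}$. Then for any $f\in\Omega$: $f\in\mathcal{I}_t(g_1,\dots,g_n)$ if and only if $f(x_1+a_1,\dots,x_n+a_n)_{[\beta]}=0$ for all $a\in\prod_{i=1}^nS_i$ and all $\beta\in\mathbb{N}^n$ with $\sum_{i=1}^n\lfloor\beta_i/\psi_i(a_i)\rfloor\leqslant t-1$. (2) Suppose every $S_k$ satisfies Condition (D) in $R$ and fix $t\in\mathbb{N}$. Let $f\in\Omega$ satisfy $f(x_1+a_1,\dots,x_n+a_n)_{[\beta]}=0$ for all $a\in\prod_iS_i$ and all $\beta\in\mathbb{N}^n$ with $\sum_i\lfloor\beta_i/\psi_i(a_i)\rfloor\leqslant t-1$. Then there exist polynomials $(p(\alpha)\mid\alpha\in\mathbb{N}^n,\sum_i\alpha_i=t)$ with $f=\sum_{\alpha}p(\alpha)\prod_{k=1}^ng_k^{\alpha_k}$ and $\mathrm{supp}(p(\alpha))+\mathrm{supp}(\prod_kg_k^{\alpha_k})\subseteq\Delta(\mathrm{supp}(f))$ for each such $\alpha$. Moreover, for every $\beta\in\max(\mathrm{supp}(f))$ there exists $\gamma\in\mathbb{N}^n$ with $\sum_i\gamma_i=t$ and $(\sum_{u\in S_k}\psi_k(u))\gamma_k\leqslant\beta_k$ for all $k\in[1,n]$. (3) Suppose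 $\prod_iS_i\neq\emptyset$ and let $t\in\mathbb{Z}^+$. Assume that every $f\in\Omega$ satisfying $f(x_1+a_1,\dots,x_n+a_n)_{[\beta]}=0$ for all $a\in\prod_iS_i$ and all $\beta\in\mathbb{N}^n$ with $\sum_i\lfloor\beta_i/\psi_i(a_i)\rfloor\leqslant t-1$ lies in $\mathcal{I}_t(g_1,\dots,g_n)$. Then every $S_k$ satisfies Condition (D) in $R$.
   Context: Let $R$ be a commutative ring with identity $1_R$, $n$ a positive integer, $[1,n]=\{1,\dots,n\}$, $\mathbb{N}=\{0,1,2,\dots\}$, $\Omega=R[x_1,\dots,x_n]$. For $\alpha,\beta\in\mathbb{N}^n$, $\alpha\leqslant\beta$ means $\alpha_i\leqslant\beta_i$ for all $i$. For $f\in\Omega$, $f_{[\alpha]}$ is the coefficient of $x_1^{\alpha_1}\cdots x_n^{\alpha_n}$ and $\mathrm{supp}(f)=\{\alpha:f_{[\alpha]}\neq0\}$. For $A,B\subseteq\mathbb{N}^n$: $\Delta(A)=\{\beta:\exists\alpha\in A,\beta\leqslant\alpha\}$, $\max(A)=\{\beta\in A:\forall\alpha\in A,\beta\leqslant\alpha\Rightarrow\beta=\alpha\}$, $A+B=\{\alpha+\beta\}$. For polynomials $g_1,\dots,g_n$ with $g_k\in R[x_k]$ monic and $t\in\mathbb{N}$, $\mathcal{I}_t(g_1,\dots,g_n)$ denotes the ideal of $\Omega$ generated by $\{\prod_{k=1}^ng_k^{\alpha_k}:\alpha\in\mathbb{N}^n,\sum_i\alpha_i=t\}$. A subset $X\subseteq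 R$ satisfies Condition (D) in $R$ if for all $a\neq b$ in $X$, $b-a$ is not a zero divisor of $R$. *)

theory Defs
  imports
    "HOL-Analysis.Finite_Cartesian_Product"
    "HOL-Library.Poly_Mapping"
    "HOL-Library.Set_Algebras"
    "HOL-Library.FuncSet"
begin

text \<open>
  The index set is a finite type \<open>'n\<close> (so \<open>n = CARD('n) \<ge> 1\<close>). Exponent vectors are elements of
  \<open>nat ^ 'n\<close>, whose library order and addition are componentwise, and the polynomial ring in the
  variables indexed by \<open>'n\<close> is the monoid algebra of finitely supported functions on \<open>nat ^ 'n\<close>,
  multiplied by convolution. The coefficient of \<open>f\<close> at \<open>\<alpha>\<close> is \<open>Poly_Mapping.lookup f \<alpha>\<close>, and the
  support of \<open>f\<close> is \<open>Poly_Mapping.keys f\<close>.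
\<close>

type_synonym ('n, 'a) mpoly = "(nat ^ 'n) \<Rightarrow>\<^sub>0 'a"

definition Const :: "'a \<Rightarrow> ('n::finite, 'a::comm_ring_1) mpoly"
  where "Const c = Poly_Mapping.single 0 c"

definition Var :: "'n \<Rightarrow> ('n::finite, 'a::comm_ring_1) mpoly"
  where "Var k = Poly_Mapping.single (axis k 1) 1"

text \<open>The polynomial \<open>f(q\<^sub>1, \<dots>, q\<^sub>n)\<close>, and its special case \<open>f(x\<^sub>1 + a\<^sub>1, \<dots>, x\<^sub>n + a\<^sub>n)\<close>.\<close>

definition substitute ::
  "('n \<Rightarrow> ('n, 'a) mpoly) \<Rightarrow> ('n::finite, 'a::comm_ring_1) mpoly \<Rightarrow> ('n, 'a) mpoly"
  where "substitute q f =
    (\<Sum>\<alpha>\<in>Poly_Mapping.keys f. Const (Poly_Mapping.lookup f \<alpha>) * (\<Prod>k\<in>UNIV. q k ^ (\<alpha> $ k)))"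

definition translate ::
  "('n \<Rightarrow> 'a) \<Rightarrow> ('n::finite, 'a::comm_ring_1) mpoly \<Rightarrow> ('n, 'a) mpoly"
  where "translate a f = substitute (\<lambda>k. Var k + Const (a k)) f"

definition total :: "nat ^ 'n::finite \<Rightarrow> nat"
  where "total \<alpha> = (\<Sum>i\<in>UNIV. \<alpha> $ i)"

definition down_closure :: "(nat ^ 'n::finite) set \<Rightarrow> (nat ^ 'n) set"
  where "down_closure A = {\<beta>. \<exists>\<alpha>\<in>A. \<beta> \<le> \<alpha>}"

definition max_elements :: "(nat ^ 'n::finite) set \<Rightarrow> (nat ^ 'n) set"
  where "max_elements A = {\<beta>\<in>A. \<forall>\<alpha>\<in>A. \<beta> \<le> \<alpha> \<longrightarrow> \<beta> = \<alpha>}"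

definition gpower ::
  "('n \<Rightarrow> ('n, 'a) mpoly) \<Rightarrow> nat ^ 'n \<Rightarrow> ('n::finite, 'a::comm_ring_1) mpoly"
  where "gpower g \<alpha> = (\<Prod>k\<in>UNIV. g k ^ (\<alpha> $ k))"

text \<open>
  A commutative ring is a module over itself, and its submodules are its ideals; so the library's
  span is the ideal generated by a set.
\<close>

lemma module_self: "module ((*) :: 'r::comm_ring_1 \<Rightarrow> 'r \<Rightarrow> 'r)"
  by standard (simp_all add: algebra_simps)

definition generated_ideal :: "'r::comm_ring_1 set \<Rightarrow> 'r set"
  where "generated_ideal G = module.span (*) G"

definition power_ideal ::
  "nat \<Rightarrow> ('n \<Rightarrow> ('n, 'a) mpoly) \<Rightarrow> ('n::finite, 'a::comm_ring_1) mpoly set"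
  where "power_ideal t g = generated_ideal {gpower g \<alpha> | \<alpha>. total \<alpha> = t}"

definition zero_divisor :: "'a::comm_ring_1 \<Rightarrow> bool"
  where "zero_divisor r \<longleftrightarrow> (\<exists>s. s \<noteq> 0 \<and> r * s = 0)"

definition condition_D :: "'a::comm_ring_1 set \<Rightarrow> bool"
  where "condition_D X \<longleftrightarrow> (\<forall>a\<in>X. \<forall>b\<in>X. a \<noteq> b \<longrightarrow> \<not> zero_divisor (b - a))"

text \<open>
  On \<open>nat\<close>, \<open>div\<close> is the floor of the quotient. The bound is compared in \<open>int\<close>, so that there is
  no condition at all for \<open>t = 0\<close>.
\<close>

definition vanishes ::
  "('n \<Rightarrow> 'a set) \<Rightarrow> ('n \<Rightarrow> 'a \<Rightarrow> nat) \<Rightarrow> nat \<Rightarrow> ('n::finite, 'a::comm_ring_1) mpoly \<Rightarrow> bool"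
  where "vanishes S \<psi> t f \<longleftrightarrow>
    (\<forall>a\<in>Pi UNIV S. \<forall>\<beta>. int (\<Sum>i\<in>UNIV. (\<beta> $ i) div \<psi> i (a i)) \<le> int t - 1
      \<longrightarrow> Poly_Mapping.lookup (translate a f) \<beta> = 0)"

end

theory Submission
  imports Defs "HOL-Computational_Algebra.Polynomial"
begin

text \<open>
  For each \<open>k\<close> list the elements of \<open>S\<^sub>k\<close> with their multiplicities \<open>\<psi>\<^sub>k\<close>, repeat this list with
  period \<open>d\<^sub>k = \<Sum>\<psi>\<^sub>k\<close>, and take the Newton polynomials of the resulting node sequence. Then
  \<open>N\<^sub>m = N\<^bsub>m mod d\<^esub> g\<^sub>k\<^bsup>m div d\<^esup>\<close>, and the products of Newton polynomials in the separate variables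
  form a basis triangular for \<open>\<le>\<close>, so expanding \<open>f\<close> involves only indices in \<open>\<Delta>(supp f)\<close>. If \<open>f\<close> satisfies
  the vanishing condition, the coefficient at each \<open>\<beta>\<close> with \<open>\<Sum>\<lfloor>\<beta>\<^sub>k / d\<^sub>k\<rfloor> < t\<close> is zero: induct on \<open>\<beta>\<close> and evaluate a Taylor
  coefficient at the point formed by the nodes of index \<open>\<beta>\<^sub>k\<close>, where the coefficient gets multiplied by
  a product of differences of nodes, which Condition (D) allows to cancel. Every remaining basis
  element is a multiple of some \<open>g\<^sup>\<alpha>\<close> with \<open>\<Sum>\<alpha> = t\<close>.

  Conversely, if \<open>(b - a) s = 0\<close> with \<open>a \<noteq> b\<close> in \<open>S\<^sub>k\<close> and \<open>s \<noteq> 0\<close>, then \<open>s g\<^sub>k\<^sup>t / (x\<^sub>k - b)\<close> satisfies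
  the vanishing condition, but its degree is too small for the ideal, since evaluating the other variables at points of the
  \<open>S\<^sub>i\<close> maps the ideal into the multiples of the monic \<open>g\<^sub>k\<^sup>t\<close>.
\<close>

section \<open>Evaluation homomorphisms and translation\<close>

lemma poly_mapping_sum_single:
  "f = (\<Sum>\<alpha>\<in>Poly_Mapping.keys f. Poly_Mapping.single \<alpha> (Poly_Mapping.lookup f \<alpha>))"
proof (rule poly_mapping_eqI)
  fix \<beta>
  have "(\<Sum>\<alpha>\<in>Poly_Mapping.keys f. Poly_Mapping.lookup f \<alpha> when \<alpha> = \<beta>) = Poly_Mapping.lookup f \<beta>"
    by (simp add: when_def in_keys_iff)
  then show "Poly_Mapping.lookup f \<beta> = Poly_Mapping.lookup
    (\<Sum>\<alpha>\<in>Poly_Mapping.keys f. Poly_Mapping.single \<alpha> (Poly_Mapping.lookup f \<alpha>)) \<beta>"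
    by (simp add: lookup_sum lookup_single)
qed

text \<open>Serves two targets: with \<open>Const\<close> the evaluation is substitution, hence
  \<open>translate\<close>; with the constant polynomials \<open>[:x:]\<close> it allows all
  variables but one to be specialised while the remaining one stays a variable.\<close>

locale coefficient_hom =
  fixes c :: "'a::comm_ring_1 \<Rightarrow> 'b::comm_ring_1"
  assumes hom_add: "c (x + y) = c x + c y"
    and hom_mult: "c (x * y) = c x * c y"
    and hom_1: "c 1 = 1"
begin

lemma hom_0: "c 0 = 0"
  using hom_add [of 0 0] by simp

definition eval :: "('n \<Rightarrow> 'b) \<Rightarrow> ('n::finite, 'a) mpoly \<Rightarrow> 'b"
  where "eval q f = (\<Sum>\<alpha>\<in>Poly_Mapping.keys f.
    c (Poly_Mapping.lookup f \<alpha>) * (\<Prod>k\<in>UNIV. q k ^ (\<alpha> $ k)))"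

lemma eval_superset:
  assumes "finite A" "Poly_Mapping.keys f \<subseteq> A"
  shows "eval q f = (\<Sum>\<alpha>\<in>A. c (Poly_Mapping.lookup f \<alpha>) * (\<Prod>k\<in>UNIV. q k ^ (\<alpha> $ k)))"
  unfolding eval_def using assms by (intro sum.mono_neutral_left) (auto simp: in_keys_iff hom_0)

lemma eval_0: "eval q 0 = 0"
  by (simp add: eval_def)

lemma eval_add: "eval q (f + g) = eval q f + eval q g"
proof -
  let ?A = "Poly_Mapping.keys f \<union> Poly_Mapping.keys g"
  have "Poly_Mapping.keys (f + g) \<subseteq> ?A" by (rule keys_add)
  then show ?thesis
    by (simp add: eval_superset [of ?A] lookup_add hom_add distrib_right sum.distrib)
qed

lemma eval_sum: "eval q (\<Sum>i\<in>I. f i) = (\<Sum>i\<in>I. eval q (f i))"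
  by (induction I rule: infinite_finite_induct) (simp_all add: eval_0 eval_add)

lemma eval_single:
  "eval q (Poly_Mapping.single \<alpha> x) = c x * (\<Prod>k\<in>UNIV. q k ^ (\<alpha> $ k))"
  by (simp add: eval_superset [of "{\<alpha>}"])

text \<open>Both factors are split into monomials; for two monomials the identity is the addition
  law for exponents together with \<open>hom_mult\<close>.\<close>

lemma eval_mult: "eval q (f * g) = eval q f * eval q g"
proof -
  let ?s = "\<lambda>h \<alpha>. Poly_Mapping.single \<alpha> (Poly_Mapping.lookup h \<alpha>)"
  have single: "eval q (?s f \<alpha> * ?s g \<beta>) = eval q (?s f \<alpha>) * eval q (?s g \<beta>)" for \<alpha> \<beta>
    by (simp add: mult_single eval_single hom_mult power_add prod.distrib ac_simps)
  have "eval q ((\<Sum>\<alpha>\<in>Poly_Mapping.keys f. ?s f \<alpha>) * (\<Sum>\<beta>\<in>Poly_Mapping.keys g. ?s g \<beta>)) =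
      eval q (\<Sum>\<alpha>\<in>Poly_Mapping.keys f. ?s f \<alpha>) * eval q (\<Sum>\<beta>\<in>Poly_Mapping.keys g. ?s g \<beta>)"
    by (simp add: sum_product eval_sum single)
  then show ?thesis
    by (simp flip: poly_mapping_sum_single)
qed

lemma eval_Const: "eval q (Const x) = c x"
  by (simp add: Const_def eval_single)

lemma eval_1: "eval q 1 = 1"
  using eval_Const [of q 1] by (simp add: Const_def hom_1)

lemma eval_Var: "eval q (Var k) = q k"
proof -
  have "(\<Prod>i\<in>UNIV. q i ^ (axis k 1 $ i)) = (\<Prod>i\<in>UNIV. if i = k then q i else 1)"
    by (rule prod.cong) (auto simp: axis_def)
  then show ?thesis by (simp add: Var_def eval_single hom_1)
qed

lemma eval_power: "eval q (f ^ m) = eval q f ^ m"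
  by (induction m) (simp_all add: eval_1 eval_mult)

lemma eval_prod: "eval q (\<Prod>i\<in>I. f i) = (\<Prod>i\<in>I. eval q (f i))"
  by (induction I rule: infinite_finite_induct) (simp_all add: eval_1 eval_mult)

end

interpretation Const: coefficient_hom "Const :: 'a \<Rightarrow> ('n::finite, 'a::comm_ring_1) mpoly"
  by standard (simp_all add: Const_def single_add mult_single)

lemma translate_eval: "translate a f = Const.eval (\<lambda>k. Var k + Const (a k)) f"
  by (simp add: translate_def substitute_def Const.eval_def)

lemma translate_0: "translate a 0 = 0"
  by (simp add: translate_eval Const.eval_0)

lemma translate_add: "translate a (f + g) = translate a f + translate a g"
  by (simp add: translate_eval Const.eval_add)

lemma translate_mult: "translate a (f * g) = translate a f * translate a g"
  by (simp add: translate_eval Const.eval_mult)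

section \<open>Products of univariate polynomials\<close>

text \<open>Encoded as evaluation at \<open>Var k\<close>, so that the recursion on
  \<open>pCons\<close> gives additivity and multiplicativity by induction, without reference to
  degrees.\<close>

definition univariate :: "'n \<Rightarrow> 'a poly \<Rightarrow> ('n::finite, 'a::comm_ring_1) mpoly"
  where "univariate k p = poly (map_poly Const p) (Var k)"

lemma univariate_0 [simp]: "univariate k 0 = 0"
  by (simp add: univariate_def)

lemma univariate_pCons: "univariate k (pCons x p) = Const x + Var k * univariate k p"
  by (simp add: univariate_def map_poly_pCons Const.hom_0)

lemma univariate_1 [simp]: "univariate k 1 = 1"
  using univariate_pCons [of k 1 0] by (simp add: Const.hom_1 one_pCons)

lemma univariate_add: "univariate k (p + q) = univariate k p + univariate k q"
  by (induction p q rule: poly_induct2)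
    (simp_all add: univariate_pCons Const.hom_add algebra_simps)

lemma univariate_smult: "univariate k (smult x p) = Const x * univariate k p"
  by (induction p) (simp_all add: univariate_pCons Const.hom_mult algebra_simps)

lemma univariate_mult: "univariate k (p * q) = univariate k p * univariate k q"
  by (induction p)
    (simp_all add: univariate_pCons univariate_add univariate_smult Const.hom_0 algebra_simps)

lemma univariate_power: "univariate k (p ^ m) = univariate k p ^ m"
  by (induction m) (simp_all add: univariate_mult)

lemma univariate_prod: "univariate k (\<Prod>i\<in>I. p i) = (\<Prod>i\<in>I. univariate k (p i))"
  by (induction I rule: infinite_finite_induct) (simp_all add: univariate_mult)

lemma univariate_sum: "univariate k (\<Sum>i\<in>I. p i) = (\<Sum>i\<in>I. univariate k (p i))"
  by (induction I rule: infinite_finite_induct) (simp_all add: univariate_add)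

lemma univariate_altdef:
  fixes k :: "'n::finite" and p :: "'a::comm_ring_1 poly"
  shows "univariate k p = (\<Sum>i\<le>Polynomial.degree p. Poly_Mapping.single (axis k i) (coeff p i))"
proof -
  have "Var k ^ i = (Poly_Mapping.single (axis k i) 1 :: ('n, 'a) mpoly)" for i
  proof (induction i)
    case 0
    have "axis k (0::nat) = 0" by (simp add: vec_eq_iff axis_def)
    then show ?case by (metis power_0 single_one)
  next
    case (Suc i)
    have "axis k (1::nat) + axis k i = axis k (Suc i)" by (simp add: vec_eq_iff axis_def)
    then show ?case by (subst power_Suc, subst Suc) (simp add: Var_def mult_single)
  qed
  moreover have "Polynomial.degree (map_poly (Const :: 'a \<Rightarrow> ('n, 'a) mpoly) p) = Polynomial.degree p"
    by (rule degree_map_poly) (auto simp: Const_def poly_mapping_eq_iff fun_eq_iff lookup_single)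
  ultimately show ?thesis
    by (simp add: univariate_def poly_altdef coeff_map_poly Const.hom_0)
      (simp add: Const_def mult_single)
qed

text \<open>The distributive law; the choice functions that pick a summand for each \<open>k\<close>
  are exactly the exponent vectors below \<open>\<gamma>\<close>.\<close>

lemma prod_sum_vec:
  fixes h :: "'n::finite \<Rightarrow> nat \<Rightarrow> 'b::comm_semiring_1"
  shows "(\<Prod>k\<in>UNIV. \<Sum>j\<le>\<gamma> $ k. h k j) = (\<Sum>\<delta>\<le>\<gamma>. \<Prod>k\<in>UNIV. h k (\<delta> $ k))"
proof -
  have "(\<Prod>k\<in>UNIV. \<Sum>j\<le>\<gamma> $ k. h k j) = (\<Sum>u\<in>Pi\<^sub>E UNIV (\<lambda>k. {..\<gamma> $ k}). \<Prod>k\<in>UNIV. h k (u k))"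
    by (rule prod_sum_PiE) auto
  also have "\<dots> = (\<Sum>\<delta>\<le>\<gamma>. \<Prod>k\<in>UNIV. h k (\<delta> $ k))"
    by (rule sum.reindex_bij_witness [of _ vec_nth vec_lambda])
      (auto simp: less_eq_vec_def PiE_def Pi_def)
  finally show ?thesis .
qed

lemma finite_atMost_vec: "finite {..\<gamma> :: nat ^ 'n::finite}"
proof -
  have "{..\<gamma>} \<subseteq> vec_lambda ` Pi\<^sub>E UNIV (\<lambda>k. {..\<gamma> $ k})"
  proof
    fix \<delta> assume "\<delta> \<in> {..\<gamma>}"
    then show "\<delta> \<in> vec_lambda ` Pi\<^sub>E UNIV (\<lambda>k. {..\<gamma> $ k})"
      by (intro image_eqI [of _ _ "vec_nth \<delta>"]) (auto simp: less_eq_vec_def)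
  qed
  then show ?thesis by (rule finite_subset) (auto intro!: finite_PiE)
qed

text \<open>Monomials, products of Newton polynomials and power products of the \<open>g k\<close>
  all have this form; coefficients and translations of such polynomials can be computed one variable
  at a time.\<close>

definition tensor :: "('n \<Rightarrow> 'a poly) \<Rightarrow> ('n::finite, 'a::comm_ring_1) mpoly"
  where "tensor p = (\<Prod>k\<in>UNIV. univariate k (p k))"

lemma tensor_mult: "tensor p * tensor q = tensor (\<lambda>k. p k * q k)"
  by (simp add: tensor_def univariate_mult prod.distrib)

lemma prod_single:
  "(\<Prod>i\<in>I. Poly_Mapping.single (\<alpha> i) (x i)) =
    Poly_Mapping.single (\<Sum>i\<in>I. \<alpha> i) (\<Prod>i\<in>I. x i :: 'a::comm_ring_1)"
  for \<alpha> :: "'i \<Rightarrow> 'm::comm_monoid_add"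
  by (induction I rule: infinite_finite_induct) (simp_all add: mult_single)

lemma sum_axis: "(\<Sum>k\<in>UNIV. axis k (\<delta> $ k)) = (\<delta> :: nat ^ 'n::finite)"
  by (simp add: vec_eq_iff axis_def)

lemma tensor_altdef:
  "tensor p = (\<Sum>\<delta>\<le>(\<chi> k. Polynomial.degree (p k)).
    Poly_Mapping.single \<delta> (\<Prod>k\<in>UNIV. coeff (p k) (\<delta> $ k)))"
  using prod_sum_vec [of "\<lambda>k i. Poly_Mapping.single (axis k i) (coeff (p k) i)"
      "\<chi> k. Polynomial.degree (p k)"]
  by (simp add: tensor_def univariate_altdef prod_single sum_axis)

text \<open>Inside the box of degrees this is read off from \<open>tensor_altdef\<close>; outside
  the box one factor on the right is a coefficient beyond the degree.\<close>

lemma lookup_tensor: "Poly_Mapping.lookup (tensor p) \<beta> = (\<Prod>k\<in>UNIV. coeff (p k) (\<beta> $ k))"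
proof -
  have "(\<Prod>k\<in>UNIV. coeff (p k) (\<beta> $ k)) = 0" if "\<not> \<beta> \<le> (\<chi> k. Polynomial.degree (p k))"
  proof -
    from that obtain k where "\<beta> $ k > Polynomial.degree (p k)"
      by (auto simp: less_eq_vec_def not_le)
    then show ?thesis by (intro prod_zero) (auto intro: coeff_eq_0)
  qed
  then show ?thesis
    by (auto simp: tensor_altdef lookup_sum lookup_single when_def finite_atMost_vec)
qed

lemma keys_tensor:
  assumes "\<beta> \<in> Poly_Mapping.keys (tensor p)"
  shows "\<beta> $ k \<le> Polynomial.degree (p k)"
proof (rule ccontr)
  assume "\<not> ?thesis"
  then have "(\<Prod>k\<in>UNIV. coeff (p k) (\<beta> $ k)) = 0"
    by (intro prod_zero) (auto intro!: exI [of _ k] coeff_eq_0)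
  with assms show False by (simp add: in_keys_iff lookup_tensor)
qed

text \<open>Multilinearity: it carries a change of basis in each single variable over to the
  polynomial ring in all variables.\<close>

lemma tensor_sum:
  fixes e :: "'n::finite \<Rightarrow> nat \<Rightarrow> 'a::comm_ring_1"
  shows "tensor (\<lambda>k. \<Sum>j\<le>\<gamma> $ k. smult (e k j) (p k j)) =
    (\<Sum>\<delta>\<le>\<gamma>. Const (\<Prod>k\<in>UNIV. e k (\<delta> $ k)) * tensor (\<lambda>k. p k (\<delta> $ k)))"
proof -
  have Const_prod: "Const (\<Prod>k\<in>UNIV. x k) = (\<Prod>k\<in>UNIV. Const (x k) :: ('n, 'a) mpoly)" for x :: "'n \<Rightarrow> 'a"
    by (simp add: Const_def prod_single)
  show ?thesis
    using prod_sum_vec [of "\<lambda>k j. Const (e k j) * univariate k (p k j)" \<gamma>]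
    by (simp add: tensor_def univariate_sum univariate_smult prod.distrib Const_prod)
qed

lemma lookup_Const_mult:
  "Poly_Mapping.lookup (Const x * f) \<beta> = x * Poly_Mapping.lookup f \<beta>"
proof -
  have "Poly_Mapping.lookup (Const x * f) = Poly_Mapping.lookup (Poly_Mapping.map ((*) x) f)"
    by (simp add: Const_def mult_map_scale_conv_mult)
  then show ?thesis by (simp add: Poly_Mapping.map.rep_eq when_def)
qed

lemma mpoly_sum_tensor_monom:
  fixes f :: "('n::finite, 'a::comm_ring_1) mpoly"
  shows "f = (\<Sum>\<gamma>\<in>Poly_Mapping.keys f. Const (Poly_Mapping.lookup f \<gamma>) * tensor (\<lambda>k. monom 1 (\<gamma> $ k)))"
proof -
  have "Const x * tensor (\<lambda>k. monom 1 (\<gamma> $ k)) = Poly_Mapping.single \<gamma> x"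
    for \<gamma> :: "nat ^ 'n" and x :: 'a
  proof (rule poly_mapping_eqI)
    fix \<beta>
    have "(\<Prod>k\<in>UNIV. if \<gamma> $ k = \<beta> $ k then 1 else 0 :: 'a) = (1 when \<gamma> = \<beta>)"
    proof (cases "\<gamma> = \<beta>")
      case False
      then obtain k where "\<gamma> $ k \<noteq> \<beta> $ k" by (auto simp: vec_eq_iff)
      then have "(\<Prod>k\<in>UNIV. if \<gamma> $ k = \<beta> $ k then 1 else 0 :: 'a) = 0"
        by (intro prod_zero) auto
      with False show ?thesis by simp
    qed simp
    then show "Poly_Mapping.lookup (Const x * tensor (\<lambda>k. monom 1 (\<gamma> $ k))) \<beta> =
        Poly_Mapping.lookup (Poly_Mapping.single \<gamma> x) \<beta>"
      by (simp add: lookup_Const_mult lookup_tensor lookup_single when_def)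
  qed
  then show ?thesis using poly_mapping_sum_single [of f] by simp
qed

lemma translate_univariate:
  "translate a (univariate k p) = univariate k (pcompose p [:a k, 1:])"
  unfolding translate_eval
  by (induction p)
    (simp_all add: univariate_pCons univariate_add univariate_smult Const.eval_0 Const.eval_add
      Const.eval_mult Const.eval_Const Const.eval_Var Const.hom_0 pcompose_pCons algebra_simps)

lemma translate_tensor: "translate a (tensor p) = tensor (\<lambda>k. pcompose (p k) [:a k, 1:])"
  using translate_univariate by (simp add: tensor_def translate_eval Const.eval_prod flip: translate_univariate)

section \<open>Newton polynomials\<close>

definition newton :: "(nat \<Rightarrow> 'a::comm_ring_1) \<Rightarrow> nat \<Rightarrow> 'a poly"
  where "newton c m = (\<Prod>j<m. [:- c j, 1:])"

text \<open>The exponent of the factor x - a visible in \<open>newton c m\<close>. With zero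
  divisors present, the true order of vanishing at \<open>a\<close> may be larger.\<close>

definition node_count :: "(nat \<Rightarrow> 'a) \<Rightarrow> nat \<Rightarrow> 'a \<Rightarrow> nat"
  where "node_count c m a = card {j. j < m \<and> c j = a}"

lemma newton_Suc: "newton c (Suc m) = newton c m * [:- c m, 1:]"
  by (simp only: newton_def prod.lessThan_Suc)

lemma degree_newton_le: "Polynomial.degree (newton c m) \<le> m"
proof -
  have "Polynomial.degree (newton c m) \<le> (\<Sum>j<m. Polynomial.degree [:- c j, 1:])"
    unfolding newton_def using degree_prod_sum_le [of "{..<m}" "\<lambda>j. [:- c j, 1:]"]
    by (simp add: o_def)
  then show ?thesis by simp
qed

text \<open>Multiplication by x sends the Newton polynomial of index j to the one of index j + 1
  plus \<open>c j\<close> times itself, so no division is required.\<close>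

lemma monom_newton_expansion: "\<exists>e. monom 1 m = (\<Sum>j\<le>m. smult (e j) (newton c j))"
proof (induction m)
  case 0
  then show ?case by (auto simp: newton_def monom_0 intro!: exI [of _ "\<lambda>_. 1"])
next
  case (Suc m)
  then obtain e where e: "monom 1 m = (\<Sum>j\<le>m. smult (e j) (newton c j))" by blast
  \<comment> \<open>The cut-off at \<open>m\<close> is essential: \<open>e\<close> is unspecified
    beyond \<open>m\<close>, while the new sum runs up to \<open>Suc m\<close>.\<close>
  define e' where "e' j = (if j \<le> m then c j * e j else 0) + (case j of 0 \<Rightarrow> 0 | Suc i \<Rightarrow> e i)" for j
  have step: "pCons 0 (newton c j) = newton c (Suc j) + smult (c j) (newton c j)" for j
    by (simp add: newton_def algebra_simps)
  have "monom 1 (Suc m) = pCons 0 1 * monom 1 m"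
    by (simp add: monom_Suc)
  also have "\<dots> = (\<Sum>j\<le>m. smult (e j) (newton c (Suc j)) + smult (c j * e j) (newton c j))"
    by (simp add: e sum_distrib_left step smult_add_right mult.commute)
  also have "\<dots> = (\<Sum>j\<le>m. smult (c j * e j) (newton c j)) + (\<Sum>j\<le>m. smult (e j) (newton c (Suc j)))"
    by (simp add: sum.distrib add.commute)
  also have "\<dots> = (\<Sum>j\<le>Suc m. smult (if j \<le> m then c j * e j else 0) (newton c j)) +
      (\<Sum>j\<le>Suc m. smult (case j of 0 \<Rightarrow> 0 | Suc i \<Rightarrow> e i) (newton c j))"
    using sum.atMost_Suc_shift
        [of "\<lambda>j. smult (case j of 0 \<Rightarrow> 0 | Suc i \<Rightarrow> e i) (newton c j)" m]
    by simp
  also have "\<dots> = (\<Sum>j\<le>Suc m. smult (e' j) (newton c j))"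
    unfolding e'_def smult_add_left sum.distrib ..
  finally show ?case by blast
qed

lemma pcompose_power: "pcompose (p ^ m) q = pcompose p q ^ m"
  for p q :: "'a::comm_ring_1 poly"
  by (induction m) (simp_all add: pcompose_mult pcompose_1)

text \<open>After the shift by \<open>a\<close>, nodes equal to \<open>a\<close> become factors x
  and every other node leaves the constant term \<open>a - c j\<close>. Hence the coefficients below
  \<open>node_count c m a\<close> vanish and the one at that index is a product of differences of
  \<open>a\<close> and nodes.\<close>

lemma newton_pcompose:
  "pcompose (newton c m) [:a, 1:] =
    monom 1 (node_count c m a) * (\<Prod>j | j < m \<and> c j \<noteq> a. [:a - c j, 1:])"
proof -
  have "pcompose (newton c m) [:a, 1:] = (\<Prod>j<m. [:a - c j, 1:])"
    by (simp add: newton_def pcompose_prod pcompose_pCons)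
  also have "{..<m} = {j. j < m \<and> c j = a} \<union> {j. j < m \<and> c j \<noteq> a}" by auto
  also have "(\<Prod>j\<in>\<dots>. [:a - c j, 1:]) =
      (\<Prod>j | j < m \<and> c j = a. [:a - c j, 1:]) * (\<Prod>j | j < m \<and> c j \<noteq> a. [:a - c j, 1:])"
    by (rule prod.union_disjoint) auto
  also have "(\<Prod>j | j < m \<and> c j = a. [:a - c j, 1:]) = monom 1 (node_count c m a)"
    by (simp add: node_count_def monom_altdef)
  finally show ?thesis .
qed

lemma coeff_newton_pcompose_less:
  "i < node_count c m a \<Longrightarrow> coeff (pcompose (newton c m) [:a, 1:]) i = 0"
  by (simp add: newton_pcompose coeff_monom_mult)

lemma coeff_newton_pcompose_node_count:
  "coeff (pcompose (newton c m) [:a, 1:]) (node_count c m a) = (\<Prod>j | j < m \<and> c j \<noteq> a. a - c j)"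
  by (simp add: newton_pcompose coeff_monom_mult flip: poly_0_coeff_0) (simp add: poly_prod)

lemma node_count_strict_mono:
  assumes "m < n"
  shows "node_count c m (c m) < node_count c n (c m)"
  unfolding node_count_def using assms by (intro psubset_card_mono) auto

text \<open>The nodes run periodically through \<open>S\<close>, each \<open>u\<close> occurring \<open>\<psi> u\<close> times per period.\<close>

lemma periodic_nodes:
  fixes S :: "'a::comm_ring_1 set"
  assumes "finite S" "S \<noteq> {}" and pos: "\<And>u. u \<in> S \<Longrightarrow> \<psi> u > 0"
  defines "d \<equiv> \<Sum>u\<in>S. \<psi> u"
  obtains c where "\<And>m. c m \<in> S"
    and "\<And>m. newton c m = newton c (m mod d) * (\<Prod>u\<in>S. [:- u, 1:] ^ \<psi> u) ^ (m div d)"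
    and "\<And>m. node_count c m (c m) div \<psi> (c m) = m div d"
proof -
  \<comment> \<open>Any enumeration of this multiset may serve as the period; only the
    multiplicities enter.\<close>
  define M where "M = (\<Sum>u\<in>S. replicate_mset (\<psi> u) u)"
  obtain xs where xs: "mset xs = M" using ex_mset by blast
  have count_M: "count M a = (if a \<in> S then \<psi> a else 0)" for a
    using \<open>finite S\<close> by (simp add: M_def count_sum)
  have len: "length xs = d"
    using xs by (simp add: M_def d_def size_multiset_sum flip: size_mset)
  have "d > 0"
    using assms unfolding d_def by (metis sum_pos)
  have set: "set xs = S"
    using arg_cong [OF xs, of set_mset] pos \<open>finite S\<close>
    by (auto simp: M_def set_mset_sum)
  define c where "c j = xs ! (j mod d)" for j
  have c_in: "c m \<in> S" for m
    using \<open>d > 0\<close> by (simp add: c_def len flip: set)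
  have G: "newton c d = (\<Prod>u\<in>S. [:- u, 1:] ^ \<psi> u)"
  proof -
    have "newton c d = (\<Prod>j<length xs. [:- xs ! j, 1:])"
      by (simp add: newton_def c_def len)
    also have "\<dots> = prod_list (map (\<lambda>u. [:- u, 1:]) xs)"
      by (simp add: prod.list_conv_set_nth atLeast0LessThan)
    also have "\<dots> = prod_mset (image_mset (\<lambda>u. [:- u, 1:]) M)"
      by (simp add: prod_mset_prod_list flip: xs mset_map)
    also have "\<dots> = (\<Prod>u\<in>S. [:- u, 1:] ^ \<psi> u)"
      using \<open>finite S\<close> unfolding M_def by (induction S) auto
    finally show ?thesis .
  qed
  have newton_add: "newton c (d + m) = newton c d * newton c m" for m
  proof (induction m)
    case (Suc m)
    have "c (d + m) = c m" by (simp add: c_def)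
    then show ?case
      using Suc by (simp only: add_Suc_right newton_Suc mult.assoc)
  qed (simp add: newton_def)
  have newton: "newton c (r + q * d) = newton c r * newton c d ^ q" for q r
    by (induction q) (simp_all add: newton_add ac_simps)
  have period: "node_count c d a = \<psi> a" if "a \<in> S" for a
  proof -
    have "{j. j < d \<and> c j = a} = {j. j < length xs \<and> a = xs ! j}"
      by (auto simp: c_def len)
    then have "node_count c d a = length (filter ((=) a) xs)"
      by (simp add: node_count_def length_filter_conv_card)
    also have "\<dots> = count M a"
      by (simp add: count_mset count_list_eq_length_filter flip: xs)
    finally show ?thesis using that by (simp add: count_M)
  qed
  have count_Suc: "node_count c (Suc m) a = node_count c m a + (if c m = a then 1 else 0)" for m a
  proof -
    have "{j. j < Suc m \<and> c j = a} =
        (if c m = a then insert m {j. j < m \<and> c j = a} else {j. j < m \<and> c j = a})"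
      by (auto simp: less_Suc_eq)
    then show ?thesis by (simp add: node_count_def)
  qed
  have count_add: "node_count c (d + m) a = node_count c d a + node_count c m a" for m a
  proof (induction m)
    case (Suc m)
    then show ?case by (simp add: count_Suc) (simp add: c_def)
  qed (simp add: node_count_def)
  have count: "node_count c (r + q * d) a = node_count c r a + q * \<psi> a" if "a \<in> S" for q r a
  proof (induction q)
    case (Suc q)
    have "r + Suc q * d = d + (r + q * d)" by simp
    then show ?case
      using Suc period [OF that] by (simp only: count_add) simp
  qed simp
  \<comment> \<open>Each full period contributes \<open>\<psi> (c m)\<close> occurrences. The
    incomplete one contributes fewer, since it stops before the position \<open>m mod d\<close>,
    where \<open>c m\<close> occurs again. So the division discards exactly the incomplete
    period.\<close>
  have "node_count c m (c m) div \<psi> (c m) = m div d" for m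
  proof -
    have eq: "c m = c (m mod d)" by (simp add: c_def)
    have "node_count c (m mod d) (c m) < node_count c d (c m)"
      unfolding eq using \<open>d > 0\<close> by (intro node_count_strict_mono) simp
    then have "node_count c (m mod d) (c m) < \<psi> (c m)"
      using period c_in by simp
    moreover have "node_count c m (c m) = node_count c (m mod d) (c m) + m div d * \<psi> (c m)"
      using count [OF c_in, of "m mod d" "m div d" m] by simp
    ultimately show ?thesis by simp
  qed
  moreover have "newton c m = newton c (m mod d) * (\<Prod>u\<in>S. [:- u, 1:] ^ \<psi> u) ^ (m div d)" for m
    using newton [of "m mod d" "m div d"] by (simp add: G)
  ultimately show ?thesis using that c_in by blast
qed

lemma zero_divisor_prod:
  assumes "\<And>i. i \<in> I \<Longrightarrow> \<not> zero_divisor (x i)"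
  shows "\<not> zero_divisor (\<Prod>i\<in>I. x i)"
  using assms
proof (induction I rule: infinite_finite_induct)
  case (insert i I)
  then show ?case
    by (auto simp: zero_divisor_def mult.assoc)
qed (auto simp: zero_divisor_def)

section \<open>Representation in terms of powers of the \<open>g\<^sub>k\<close>\<close>

text \<open>Each monomial of \<open>f\<close> is expanded variable by variable, which produces only
  indices below its exponent; interchanging the two sums collects the coefficient of each
  index.\<close>

lemma newton_expansion:
  fixes f :: "('n::finite, 'a::comm_ring_1) mpoly" and c :: "'n \<Rightarrow> nat \<Rightarrow> 'a"
  defines "D \<equiv> down_closure (Poly_Mapping.keys f)"
  obtains b where "finite D"
    and "f = (\<Sum>\<beta>\<in>D. Const (b \<beta>) * tensor (\<lambda>k. newton (c k) (\<beta> $ k)))"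
proof -
  let ?K = "Poly_Mapping.keys f" and ?N = "\<lambda>\<beta>. tensor (\<lambda>k. newton (c k) (\<beta> $ k)) :: ('n, 'a) mpoly"
  have "\<exists>e. \<forall>k m. monom 1 m = (\<Sum>j\<le>m. smult (e k m j) (newton (c k) j))"
    by (intro choice allI monom_newton_expansion)
  then obtain e where e: "\<And>k m. monom 1 m = (\<Sum>j\<le>m. smult (e k m j) (newton (c k) j))"
    by blast
  have D: "D = (\<Union>\<gamma>\<in>?K. {..\<gamma>})"
    by (auto simp: D_def down_closure_def)
  then have fin: "finite D"
    by (simp add: finite_atMost_vec)
  define b' where "b' \<gamma> \<beta> = Poly_Mapping.lookup f \<gamma> * (\<Prod>k\<in>UNIV. e k (\<gamma> $ k) (\<beta> $ k))" for \<gamma> \<beta>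
  define b where "b \<beta> = (\<Sum>\<gamma> | \<gamma> \<in> ?K \<and> \<beta> \<le> \<gamma>. b' \<gamma> \<beta>)" for \<beta>
  have "tensor (\<lambda>k. monom 1 (\<gamma> $ k)) =
      (\<Sum>\<beta>\<le>\<gamma>. Const (\<Prod>k\<in>UNIV. e k (\<gamma> $ k) (\<beta> $ k)) * ?N \<beta>)" for \<gamma>
  proof -
    have "(\<lambda>k. monom 1 (\<gamma> $ k)) = (\<lambda>k. \<Sum>j\<le>\<gamma> $ k. smult (e k (\<gamma> $ k) j) (newton (c k) j))"
      by (intro ext e)
    then show ?thesis by (simp only: tensor_sum)
  qed
  then have "f = (\<Sum>\<gamma>\<in>?K. \<Sum>\<beta>\<le>\<gamma>. Const (b' \<gamma> \<beta>) * ?N \<beta>)"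
    using mpoly_sum_tensor_monom [of f]
    by (simp add: b'_def sum_distrib_left Const.hom_mult mult.assoc)
  also have "\<dots> = (\<Sum>\<gamma>\<in>?K. \<Sum>\<beta> | \<beta> \<in> D \<and> \<beta> \<le> \<gamma>. Const (b' \<gamma> \<beta>) * ?N \<beta>)"
    by (intro sum.cong refl) (auto simp: D)
  also have "\<dots> = (\<Sum>\<beta>\<in>D. \<Sum>\<gamma> | \<gamma> \<in> ?K \<and> \<beta> \<le> \<gamma>. Const (b' \<gamma> \<beta>) * ?N \<beta>)"
    using fin by (intro sum.swap_restrict) simp_all
  also have "\<dots> = (\<Sum>\<beta>\<in>D. Const (b \<beta>) * ?N \<beta>)"
  proof -
    have Const_sum: "Const (\<Sum>i\<in>I. x i) = (\<Sum>i\<in>I. Const (x i) :: ('n, 'a) mpoly)"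
      for I and x :: "nat ^ 'n \<Rightarrow> 'a"
      by (induction I rule: infinite_finite_induct) (simp_all add: Const.hom_0 Const.hom_add)
    show ?thesis by (simp add: b_def Const_sum sum_distrib_right)
  qed
  finally show ?thesis using fin that by blast
qed

lemma lookup_translate_newton_expansion:
  "Poly_Mapping.lookup (translate a (\<Sum>\<beta>\<in>B. Const (b \<beta>) * tensor (\<lambda>k. newton (c k) (\<beta> $ k)))) \<epsilon> =
    (\<Sum>\<beta>\<in>B. b \<beta> * (\<Prod>k\<in>UNIV. coeff (pcompose (newton (c k) (\<beta> $ k)) [:a k, 1:]) (\<epsilon> $ k)))"
  unfolding translate_eval Const.eval_sum Const.eval_mult Const.eval_Const
  unfolding translate_eval [symmetric] translate_tensor lookup_sum lookup_Const_mult lookup_tensor ..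

text \<open>A triangularity argument. An index not below \<open>\<beta>\<close> contributes zero
  because the node of index \<open>\<beta> $ k\<close> is counted there once more for some
  \<open>k\<close>; an index strictly below has smaller \<open>total\<close> and no larger quotient
  sum, so its coefficient is zero by induction. What remains is \<open>b \<beta>\<close> times a
  product of differences of distinct nodes.\<close>

lemma newton_coefficient_eq_0:
  fixes b :: "nat ^ 'n::finite \<Rightarrow> 'a::comm_ring_1"
  assumes D: "\<And>k. condition_D (S k)"
    and c: "\<And>k m. c k m \<in> S k"
    and count: "\<And>k m. node_count (c k) m (c k m) div \<psi> k (c k m) = m div d k"
    and "finite B"
    and van: "vanishes S \<psi> t (\<Sum>\<beta>\<in>B. Const (b \<beta>) * tensor (\<lambda>k. newton (c k) (\<beta> $ k)))"
    and "\<beta> \<in> B" "(\<Sum>k\<in>UNIV. \<beta> $ k div d k) < t"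
  shows "b \<beta> = 0"
  using \<open>\<beta> \<in> B\<close> \<open>(\<Sum>k\<in>UNIV. \<beta> $ k div d k) < t\<close>
proof (induction \<beta> rule: measure_induct_rule [of total])
  case (less \<beta>)
  \<comment> \<open>At the node \<open>a\<close> only the terms with index \<open>\<le> \<beta>\<close> contribute to the coefficient at \<open>\<epsilon>\<close>.\<close>
  define a where "a k = c k (\<beta> $ k)" for k
  \<comment> \<open>The exponent at which the basis element of index \<open>\<beta>\<close>,
    translated by \<open>a\<close>, has the product of node differences as coefficient. By
    \<open>count\<close> its floors agree with \<open>\<beta> $ k div d k\<close>, so the vanishing
    hypothesis covers it.\<close>
  define \<epsilon> :: "nat ^ 'n" where "\<epsilon> = (\<chi> k. node_count (c k) (\<beta> $ k) (a k))"
  define w where "w \<gamma> = (\<Prod>k\<in>UNIV. coeff (pcompose (newton (c k) (\<gamma> $ k)) [:a k, 1:]) (\<epsilon> $ k))"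
    for \<gamma> :: "nat ^ 'n"
  have others: "b \<gamma> * w \<gamma> = 0" if "\<gamma> \<in> B - {\<beta>}" for \<gamma>
  proof (cases "\<gamma> \<le> \<beta>")
    case True
    then have le: "\<gamma> $ k \<le> \<beta> $ k" for k by (simp add: less_eq_vec_def)
    from that obtain k where "\<gamma> $ k \<noteq> \<beta> $ k" by (auto simp: vec_eq_iff)
    with le [of k] have "\<gamma> $ k < \<beta> $ k" by simp
    with le have "total \<gamma> < total \<beta>"
      unfolding total_def by (intro sum_strict_mono_ex1) auto
    moreover have "(\<Sum>k\<in>UNIV. \<gamma> $ k div d k) \<le> (\<Sum>k\<in>UNIV. \<beta> $ k div d k)"
      by (intro sum_mono div_le_mono le)
    ultimately show ?thesis using less that by simp
  next
    case False
    then obtain k where "\<beta> $ k < \<gamma> $ k" by (auto simp: less_eq_vec_def not_le)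
    then have "coeff (pcompose (newton (c k) (\<gamma> $ k)) [:a k, 1:]) (\<epsilon> $ k) = 0"
      by (auto simp: \<epsilon>_def a_def intro!: coeff_newton_pcompose_less node_count_strict_mono)
    then have "w \<gamma> = 0" unfolding w_def by (intro prod_zero) auto
    then show ?thesis by simp
  qed
  have "(\<Sum>k\<in>UNIV. \<epsilon> $ k div \<psi> k (a k)) < t"
    using less.prems(2) by (simp add: \<epsilon>_def a_def count)
  then have "int (\<Sum>k\<in>UNIV. \<epsilon> $ k div \<psi> k (a k)) \<le> int t - 1"
    by linarith
  moreover have "a \<in> Pi UNIV S" by (simp add: a_def c)
  ultimately have "(\<Sum>\<gamma>\<in>B. b \<gamma> * w \<gamma>) = 0"
    using van unfolding vanishes_def lookup_translate_newton_expansion w_def by blast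
  then have "w \<beta> * b \<beta> = 0"
    using others less.prems(1) \<open>finite B\<close> by (simp add: sum.remove mult.commute)
  moreover have "\<not> zero_divisor (w \<beta>)"
  proof -
    have "w \<beta> = (\<Prod>k\<in>UNIV. \<Prod>j | j < \<beta> $ k \<and> c k j \<noteq> a k. a k - c k j)"
      by (simp add: w_def \<epsilon>_def coeff_newton_pcompose_node_count)
    moreover have "\<not> zero_divisor (a k - c k j)" if "c k j \<noteq> a k" for k j
      using D [of k] c that by (auto simp: condition_D_def a_def)
    ultimately show ?thesis by (auto intro!: zero_divisor_prod)
  qed
  ultimately show ?case by (auto simp: zero_divisor_def)
qed

text \<open>Coordinates are lowered one unit at a time. This trims a vector of quotients to total
  exactly \<open>t\<close>.\<close>

lemma exists_total_le:
  fixes \<gamma> :: "nat ^ 'n::finite"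
  assumes "t \<le> total \<gamma>"
  shows "\<exists>\<alpha>\<le>\<gamma>. total \<alpha> = t"
proof -
  have "\<exists>\<alpha>\<le>\<gamma>. total \<alpha> = total \<gamma> - m" for m
  proof (induction m)
    case (Suc m)
    then obtain \<alpha> where \<alpha>: "\<alpha> \<le> \<gamma>" "total \<alpha> = total \<gamma> - m" by blast
    show ?case
    proof (cases "total \<alpha> = 0")
      \<comment> \<open>With truncated subtraction \<open>total \<gamma> - m\<close> is already 0
        here, hence so is \<open>total \<gamma> - Suc m\<close>.\<close>
      case True
      then show ?thesis using \<alpha> by (intro exI [of _ \<alpha>]) simp
    next
      case False
      then obtain k where k: "\<alpha> $ k > 0" by (auto simp: total_def)
      define \<delta> :: "nat ^ 'n" where "\<delta> = (\<chi> i. if i = k then \<alpha> $ k - 1 else \<alpha> $ i)"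
      have "total \<alpha> = \<alpha> $ k + (\<Sum>i\<in>UNIV - {k}. \<alpha> $ i)"
        unfolding total_def by (rule sum.remove) auto
      moreover have "total \<delta> = \<delta> $ k + (\<Sum>i\<in>UNIV - {k}. \<delta> $ i)"
        unfolding total_def by (rule sum.remove) auto
      moreover have "(\<Sum>i\<in>UNIV - {k}. \<delta> $ i) = (\<Sum>i\<in>UNIV - {k}. \<alpha> $ i)"
        by (rule sum.cong) (auto simp: \<delta>_def)
      ultimately have "total \<delta> = total \<gamma> - Suc m"
        using k \<alpha> by (simp add: \<delta>_def)
      moreover have "\<delta> $ i \<le> \<gamma> $ i" for i
        using \<alpha> by (simp add: \<delta>_def less_eq_vec_def) (meson diff_le_self le_trans)
      then have "\<delta> \<le> \<gamma>" by (simp add: less_eq_vec_def)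
      ultimately show ?thesis by blast
    qed
  qed auto
  from this [of "total \<gamma> - t"] show ?thesis using assms by simp
qed

lemma finite_total_eq: "finite {\<alpha> :: nat ^ 'n::finite. total \<alpha> = t}"
proof (rule finite_subset)
  show "{\<alpha> :: nat ^ 'n. total \<alpha> = t} \<subseteq> {..\<chi> k. t}"
    by (auto simp: less_eq_vec_def total_def intro!: member_le_sum)
qed (rule finite_atMost_vec)

lemma gpower_tensor:
  assumes "\<And>k. g k = univariate k (G k)"
  shows "gpower g \<alpha> = tensor (\<lambda>k. G k ^ (\<alpha> $ k))"
  by (simp add: gpower_def tensor_def assms univariate_power)

lemma univariate_node_poly:
  fixes k :: "'n::finite" and \<psi> :: "'a::comm_ring_1 \<Rightarrow> nat"
  shows "(\<Prod>u\<in>S. (Var k - Const u) ^ \<psi> u) = univariate k (\<Prod>u\<in>S. [:- u, 1:] ^ \<psi> u)"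
proof -
  have "univariate k [:- u, 1:] = Var k - Const u" for u :: 'a
    by (simp add: univariate_pCons Const.hom_1 Const.hom_0)
      (simp add: Const_def single_uminus)
  then show ?thesis by (simp add: univariate_prod univariate_power)
qed

text \<open>Degrees need not add up over a ring with zero divisors; they do here because the product
  of the leading coefficients is 1.\<close>

lemma monic_mult:
  fixes p q :: "'a::comm_ring_1 poly"
  assumes "lead_coeff p = 1" "lead_coeff q = 1"
  shows "Polynomial.degree (p * q) = Polynomial.degree p + Polynomial.degree q"
    and "lead_coeff (p * q) = 1"
proof -
  have "coeff (p * q) (Polynomial.degree p + Polynomial.degree q) = 1"
    using assms by (simp add: coeff_mult_degree_sum)
  moreover from this show "Polynomial.degree (p * q) = Polynomial.degree p + Polynomial.degree q"
    by (intro antisym degree_mult_le le_degree) simp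
  ultimately show "lead_coeff (p * q) = 1" by simp
qed

lemma monic_power:
  fixes p :: "'a::comm_ring_1 poly"
  assumes "lead_coeff p = 1"
  shows "Polynomial.degree (p ^ m) = Polynomial.degree p * m" "lead_coeff (p ^ m) = 1"
proof -
  have "Polynomial.degree (p ^ m) = Polynomial.degree p * m \<and> lead_coeff (p ^ m) = 1"
  proof (induction m)
    case (Suc m)
    show ?case
      using monic_mult [OF assms conjunct2 [OF Suc]] conjunct1 [OF Suc] by simp
  qed simp
  then show "Polynomial.degree (p ^ m) = Polynomial.degree p * m" "lead_coeff (p ^ m) = 1"
    by - (erule conjunct1, erule conjunct2)
qed

lemma monic_node_poly:
  fixes S :: "'a::comm_ring_1 set"
  assumes "finite S"
  shows "Polynomial.degree (\<Prod>u\<in>S. [:- u, 1:] ^ \<psi> u) = (\<Sum>u\<in>S. \<psi> u)"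
    and "lead_coeff (\<Prod>u\<in>S. [:- u, 1:] ^ \<psi> u) = 1"
proof -
  have "Polynomial.degree (\<Prod>u\<in>S. [:- u, 1:] ^ \<psi> u) = (\<Sum>u\<in>S. \<psi> u) \<and>
      lead_coeff (\<Prod>u\<in>S. [:- u, 1:] ^ \<psi> u) = 1"
    using assms
  proof (induction S)
    case (insert u S)
    have "lead_coeff [:- u, 1:] = 1" by simp
    note monic = monic_power [OF this, of "\<psi> u"]
    show ?case
      using monic_mult [OF monic(2) conjunct2 [OF insert.IH]] conjunct1 [OF insert.IH] monic(1)
        insert.hyps by simp
  qed simp
  then show "Polynomial.degree (\<Prod>u\<in>S. [:- u, 1:] ^ \<psi> u) = (\<Sum>u\<in>S. \<psi> u)"
    "lead_coeff (\<Prod>u\<in>S. [:- u, 1:] ^ \<psi> u) = 1"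
    by - (erule conjunct1, erule conjunct2)
qed

text \<open>Every Newton basis element whose coefficient may survive has quotient sum at least
  \<open>t\<close>, so some power product of total exactly \<open>t\<close> splits off from it.
  Grouping the terms by this power product gives the \<open>p \<alpha>\<close>.\<close>

lemma vanishes_representation:
  fixes S :: "'n::finite \<Rightarrow> 'a::comm_ring_1 set"
  assumes fin: "\<And>k. finite (S k)"
    and pos: "\<And>k u. u \<in> S k \<Longrightarrow> \<psi> k u > 0"
    and G: "\<And>k. G k = (\<Prod>u\<in>S k. [:- u, 1:] ^ \<psi> k u)"
    and g: "\<And>k. g k = univariate k (G k)"
    and D: "\<And>k. condition_D (S k)"
    and van: "vanishes S \<psi> t f"
  shows "\<exists>p. f = (\<Sum>\<alpha> | total \<alpha> = t. p \<alpha> * gpower g \<alpha>) \<and>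
             (\<forall>\<alpha>. total \<alpha> = t \<longrightarrow>
                Poly_Mapping.keys (p \<alpha>) + Poly_Mapping.keys (gpower g \<alpha>)
                  \<subseteq> down_closure (Poly_Mapping.keys f))"
proof (cases "\<exists>k. S k = {}")
  case True
  then obtain k where k: "S k = {}" by blast
  \<comment> \<open>An empty \<open>S k\<close> supplies no nodes, but then \<open>g k = 1\<close>,
    so the power product at \<open>\<alpha>\<^sub>0\<close> is 1 and \<open>f\<close> itself can be
    its coefficient.\<close>
  define \<alpha>\<^sub>0 :: "nat ^ 'n" where "\<alpha>\<^sub>0 = axis k t"
  have "total \<alpha>\<^sub>0 = t" by (simp add: \<alpha>\<^sub>0_def total_def axis_def)
  have "g k = 1" using k by (simp add: g G)
  then have "g i ^ (\<alpha>\<^sub>0 $ i) = 1" for i by (simp add: \<alpha>\<^sub>0_def axis_def)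
  then have gp: "gpower g \<alpha>\<^sub>0 = 1"
    by (simp add: gpower_def)
  show ?thesis
  proof (intro exI [of _ "\<lambda>\<alpha>. if \<alpha> = \<alpha>\<^sub>0 then f else 0"] conjI allI impI)
    have "(\<Sum>\<alpha> | total \<alpha> = t. (if \<alpha> = \<alpha>\<^sub>0 then f else 0) * gpower g \<alpha>) =
        (\<Sum>\<alpha> | total \<alpha> = t. if \<alpha> = \<alpha>\<^sub>0 then f else 0)"
      by (rule sum.cong) (auto simp: gp)
    then show "f = (\<Sum>\<alpha> | total \<alpha> = t. (if \<alpha> = \<alpha>\<^sub>0 then f else 0) * gpower g \<alpha>)"
      using \<open>total \<alpha>\<^sub>0 = t\<close> by (simp add: finite_total_eq)
  qed (auto simp: gp set_plus_def down_closure_def)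
next
  case False
  define d where "d k = (\<Sum>u\<in>S k. \<psi> k u)" for k
  have "\<exists>c. (\<forall>m. c m \<in> S k) \<and>
      (\<forall>m. newton c m = newton c (m mod d k) * G k ^ (m div d k)) \<and>
      (\<forall>m. node_count c m (c m) div \<psi> k (c m) = m div d k)" for k
    by (rule periodic_nodes [OF fin [of k], of "\<psi> k"]) (use False pos in \<open>auto simp: G d_def\<close>)
  then have "\<exists>c. \<forall>k. (\<forall>m. c k m \<in> S k) \<and>
      (\<forall>m. newton (c k) m = newton (c k) (m mod d k) * G k ^ (m div d k)) \<and>
      (\<forall>m. node_count (c k) m (c k m) div \<psi> k (c k m) = m div d k)"
    by (intro choice allI)
  then obtain c where c: "\<And>k m. c k m \<in> S k"
    and newton: "\<And>k m. newton (c k) m = newton (c k) (m mod d k) * G k ^ (m div d k)"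
    and count: "\<And>k m. node_count (c k) m (c k m) div \<psi> k (c k m) = m div d k"
    by blast
  let ?D = "down_closure (Poly_Mapping.keys f)"
  obtain b where "finite ?D"
    and f: "f = (\<Sum>\<beta>\<in>?D. Const (b \<beta>) * tensor (\<lambda>k. newton (c k) (\<beta> $ k)))"
    by (rule newton_expansion)
  define q :: "nat ^ 'n \<Rightarrow> nat ^ 'n" where "q \<beta> = (\<chi> k. \<beta> $ k div d k)" for \<beta>
  define B where "B = {\<beta> \<in> ?D. t \<le> total (q \<beta>)}"
  have "finite B" using \<open>finite ?D\<close> by (simp add: B_def)
  have zero: "b \<beta> = 0" if "\<beta> \<in> ?D - B" for \<beta>
  proof (rule newton_coefficient_eq_0 [OF D c count \<open>finite ?D\<close>])
    show "vanishes S \<psi> t (\<Sum>\<beta>\<in>?D. Const (b \<beta>) * tensor (\<lambda>k. newton (c k) (\<beta> $ k)))"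
      using van f by simp
    show "\<beta> \<in> ?D" "(\<Sum>k\<in>UNIV. \<beta> $ k div d k) < t"
      using that by (auto simp: B_def q_def total_def not_le)
  qed
  have "\<forall>\<beta>\<in>B. \<exists>\<alpha>. \<alpha> \<le> q \<beta> \<and> total \<alpha> = t"
    using exists_total_le by (auto simp: B_def)
  from bchoice [OF this] obtain A
    where "\<forall>\<beta>\<in>B. A \<beta> \<le> q \<beta> \<and> total (A \<beta>) = t" ..
  then have A: "A \<beta> \<le> q \<beta> \<and> total (A \<beta>) = t" if "\<beta> \<in> B" for \<beta>
    using that by (rule bspec)
  \<comment> \<open>The cofactor left after \<open>gpower g (A \<beta>)\<close> is split off; the
    subtraction is exact because \<open>A \<beta> \<le> q \<beta>\<close>.\<close>
  define r where "r \<beta> k = newton (c k) (\<beta> $ k mod d k) * G k ^ (q \<beta> $ k - A \<beta> $ k)" for \<beta> k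
  have split: "tensor (\<lambda>k. newton (c k) (\<beta> $ k)) = tensor (r \<beta>) * gpower g (A \<beta>)" if "\<beta> \<in> B" for \<beta>
  proof -
    have "newton (c k) (\<beta> $ k) = r \<beta> k * G k ^ (A \<beta> $ k)" for k
      using A [OF that] newton [of k "\<beta> $ k"]
      by (simp add: r_def q_def less_eq_vec_def mult.assoc flip: power_add)
    then show ?thesis by (simp add: gpower_tensor [OF g] tensor_mult)
  qed
  define p where "p \<alpha> = (\<Sum>\<beta> | \<beta> \<in> B \<and> A \<beta> = \<alpha>. Const (b \<beta>) * tensor (r \<beta>))" for \<alpha>
  have degree_G: "Polynomial.degree (G k ^ m) \<le> d k * m" for k m
    unfolding G d_def monic_power [OF monic_node_poly(2) [OF fin]] monic_node_poly [OF fin]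
    by (rule order_refl)
  show ?thesis
  proof (intro exI [of _ p] conjI allI impI)
    have "f = (\<Sum>\<beta>\<in>?D. Const (b \<beta>) * tensor (\<lambda>k. newton (c k) (\<beta> $ k)))"
      by (rule f)
    also have "\<dots> = (\<Sum>\<beta>\<in>B. Const (b \<beta>) * tensor (\<lambda>k. newton (c k) (\<beta> $ k)))"
    proof (rule sum.mono_neutral_right)
      show "B \<subseteq> ?D" by (auto simp: B_def)
      show "\<forall>\<beta>\<in>?D - B. Const (b \<beta>) * tensor (\<lambda>k. newton (c k) (\<beta> $ k)) = 0"
        by (intro ballI) (simp only: zero Const.hom_0 mult_zero_left)
    qed (rule \<open>finite ?D\<close>)
    also have "\<dots> = (\<Sum>\<beta>\<in>B. Const (b \<beta>) * tensor (r \<beta>) * gpower g (A \<beta>))"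
      by (simp add: split mult.assoc)
    also have "\<dots> = (\<Sum>\<alpha> | total \<alpha> = t. \<Sum>\<beta> | \<beta> \<in> B \<and> A \<beta> = \<alpha>.
        Const (b \<beta>) * tensor (r \<beta>) * gpower g (A \<beta>))"
      using A by (intro sum.group [symmetric] \<open>finite B\<close> finite_total_eq) auto
    also have "\<dots> = (\<Sum>\<alpha> | total \<alpha> = t. p \<alpha> * gpower g \<alpha>)"
      by (simp add: p_def sum_distrib_right)
    finally show "f = (\<Sum>\<alpha> | total \<alpha> = t. p \<alpha> * gpower g \<alpha>)" .
  next
    fix \<alpha> :: "nat ^ 'n"
    show "Poly_Mapping.keys (p \<alpha>) + Poly_Mapping.keys (gpower g \<alpha>) \<subseteq> ?D"
    proof
      fix \<eta> assume "\<eta> \<in> Poly_Mapping.keys (p \<alpha>) + Poly_Mapping.keys (gpower g \<alpha>)"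
      then obtain \<delta> \<epsilon> where \<eta>: "\<eta> = \<delta> + \<epsilon>" and \<delta>: "\<delta> \<in> Poly_Mapping.keys (p \<alpha>)"
        and \<epsilon>: "\<epsilon> \<in> Poly_Mapping.keys (gpower g \<alpha>)"
        by (auto simp: set_plus_def)
      have "\<delta> \<in> (\<Union>\<beta>\<in>{\<beta> \<in> B. A \<beta> = \<alpha>}. Poly_Mapping.keys (Const (b \<beta>) * tensor (r \<beta>)))"
        using \<delta> unfolding p_def by (rule subsetD [OF keys_sum])
      then obtain \<beta> where \<beta>: "\<beta> \<in> B" "A \<beta> = \<alpha>"
        and "\<delta> \<in> Poly_Mapping.keys (Const (b \<beta>) * tensor (r \<beta>))"
        by auto
      then have \<delta>: "\<delta> \<in> Poly_Mapping.keys (tensor (r \<beta>))"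
        by (auto simp: in_keys_iff lookup_Const_mult)
      \<comment> \<open>The degree bounds of cofactor and power product add up to the remainder plus
        \<open>d k\<close> times the quotient of \<open>\<beta> $ k\<close>, that is, to
        \<open>\<beta> $ k\<close>.\<close>
      have "\<eta> $ k \<le> \<beta> $ k" for k
      proof -
        have "\<delta> $ k \<le> Polynomial.degree (r \<beta> k)"
          using \<delta> by (rule keys_tensor)
        also have "\<dots> \<le> Polynomial.degree (newton (c k) (\<beta> $ k mod d k)) +
            Polynomial.degree (G k ^ (q \<beta> $ k - A \<beta> $ k))"
          unfolding r_def by (rule degree_mult_le)
        also have "\<dots> \<le> \<beta> $ k mod d k + d k * (q \<beta> $ k - A \<beta> $ k)"
          by (intro add_mono degree_newton_le degree_G)
        finally have "\<delta> $ k \<le> \<beta> $ k mod d k + d k * (q \<beta> $ k - A \<beta> $ k)" .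
        moreover have "\<epsilon> $ k \<le> d k * A \<beta> $ k"
          using keys_tensor [OF \<epsilon> [unfolded gpower_tensor [OF g]], of k] degree_G \<beta>(2) le_trans by blast
        moreover obtain e where "q \<beta> $ k = A \<beta> $ k + e"
          using A [OF \<beta>(1)] by (auto simp: less_eq_vec_def le_iff_add)
        ultimately have "\<eta> $ k \<le> \<beta> $ k mod d k + d k * q \<beta> $ k"
          by (simp add: \<eta> algebra_simps)
        then show ?thesis by (simp add: q_def)
      qed
      then have "\<eta> \<le> \<beta>" by (simp add: less_eq_vec_def)
      moreover have "\<beta> \<in> ?D" using \<beta> by (simp add: B_def)
      ultimately show "\<eta> \<in> ?D"
        by (auto simp: down_closure_def intro: order.trans)
    qed
  qed
qed

section \<open>Ideal membership implies vanishing\<close>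

lemma generated_ideal_minimal:
  assumes "G \<subseteq> V" "0 \<in> V" "\<And>x y. x \<in> V \<Longrightarrow> y \<in> V \<Longrightarrow> x + y \<in> V" "\<And>r x. x \<in> V \<Longrightarrow> r * x \<in> V"
  shows "generated_ideal G \<subseteq> V"
  unfolding generated_ideal_def
  using assms by (intro module.span_minimal [OF module_self]) (auto simp: module.subspace_def [OF module_self])

lemma generated_ideal_sum:
  "(\<And>i. i \<in> I \<Longrightarrow> x i \<in> G) \<Longrightarrow> (\<Sum>i\<in>I. r i * x i) \<in> generated_ideal G"
  unfolding generated_ideal_def
  by (intro module.span_sum [OF module_self] module.span_scale [OF module_self]
      module.span_base [OF module_self])

text \<open>The shift by \<open>a\<close> turns x - a into x, so the shifted polynomial is divisible
  by the \<open>m\<close>-th power of x.\<close>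

lemma dvd_imp_coeff_pcompose_eq_0:
  fixes p :: "'a::comm_ring_1 poly"
  assumes "[:- a, 1:] ^ m dvd p" "i < m"
  shows "coeff (pcompose p [:a, 1:]) i = 0"
proof -
  from assms obtain q where "p = [:- a, 1:] ^ m * q" by (auto elim: dvdE)
  moreover have "pcompose [:- a, 1:] [:a, 1:] = monom 1 1"
    by (simp add: pcompose_pCons monom_altdef)
  ultimately have "pcompose p [:a, 1:] = monom 1 m * pcompose q [:a, 1:]"
    by (simp add: pcompose_mult pcompose_power monom_power)
  then show ?thesis using assms by (simp add: coeff_monom_mult)
qed

lemma linear_power_dvd_node_poly:
  fixes S :: "'a::comm_ring_1 set"
  shows "finite S \<Longrightarrow> a \<in> S \<Longrightarrow> [:- a, 1:] ^ \<psi> a dvd (\<Prod>u\<in>S. [:- u, 1:] ^ \<psi> u)"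
  by (rule dvd_prodI)

lemma power_ideal_vanishes:
  fixes S :: "'n::finite \<Rightarrow> 'a::comm_ring_1 set"
  assumes fin: "\<And>k. finite (S k)"
    and pos: "\<And>k u. u \<in> S k \<Longrightarrow> \<psi> k u > 0"
    and G: "\<And>k. G k = (\<Prod>u\<in>S k. [:- u, 1:] ^ \<psi> k u)"
    and g: "\<And>k. g k = univariate k (G k)"
    and "f \<in> power_ideal t g"
  shows "vanishes S \<psi> t f"
proof -
  define w where "w a \<beta> = (\<Sum>i\<in>UNIV. (\<beta> $ i) div \<psi> i (a i))" for a and \<beta> :: "nat ^ 'n"
  define V :: "('n, 'a) mpoly set"
    \<comment> \<open>The vanishing condition in contrapositive form. Since the weight
      \<open>w a\<close> only grows when exponents are added, \<open>V\<close> is visibly an ideal,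
      and it suffices to test the generators.\<close>
    where "V = {f. \<forall>a\<in>Pi UNIV S. \<forall>\<beta>\<in>Poly_Mapping.keys (translate a f). t \<le> w a \<beta>}"
  have "generated_ideal {gpower g \<alpha> | \<alpha>. total \<alpha> = t} \<subseteq> V"
  proof (rule generated_ideal_minimal)
    show "{gpower g \<alpha> | \<alpha>. total \<alpha> = t} \<subseteq> V"
    proof (clarsimp simp: V_def)
      fix \<alpha> \<beta> :: "nat ^ 'n" and a
      assume a: "a \<in> Pi UNIV S" and \<beta>: "\<beta> \<in> Poly_Mapping.keys (translate a (gpower g \<alpha>))"
      have "\<alpha> $ k \<le> \<beta> $ k div \<psi> k (a k)" for k
      proof (rule ccontr)
        assume "\<not> ?thesis"
        moreover have "\<psi> k (a k) > 0" using a pos by auto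
        ultimately have "\<beta> $ k < \<psi> k (a k) * \<alpha> $ k"
          by (simp add: not_le div_less_iff_less_mult mult.commute)
        moreover have "[:- a k, 1:] ^ (\<psi> k (a k) * \<alpha> $ k) dvd G k ^ (\<alpha> $ k)"
          unfolding power_mult G using a
          by (intro dvd_power_same linear_power_dvd_node_poly fin) auto
        ultimately have "coeff (pcompose (G k ^ (\<alpha> $ k)) [:a k, 1:]) (\<beta> $ k) = 0"
          by (intro dvd_imp_coeff_pcompose_eq_0)
        then have "Poly_Mapping.lookup (translate a (gpower g \<alpha>)) \<beta> = 0"
          unfolding gpower_tensor [OF g] translate_tensor lookup_tensor
          by (intro prod_zero) auto
        with \<beta> show False by (simp add: in_keys_iff)
      qed
      then show "total \<alpha> \<le> w a \<beta>"
        unfolding total_def w_def by (rule sum_mono)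
    qed
  next
    fix x y assume "x \<in> V" "y \<in> V"
    then show "x + y \<in> V"
      by (auto simp: V_def translate_add dest!: subsetD [OF keys_add])
  next
    fix r x assume x: "x \<in> V"
    have "t \<le> w a \<beta>" if a: "a \<in> Pi UNIV S" and \<beta>: "\<beta> \<in> Poly_Mapping.keys (translate a (r * x))" for a \<beta>
    proof -
      from \<beta> obtain \<gamma> \<delta> where "\<beta> = \<gamma> + \<delta>" "\<delta> \<in> Poly_Mapping.keys (translate a x)"
        using keys_mult [of "translate a r" "translate a x"]
        by (auto simp: translate_mult)
      moreover from this x a have "t \<le> w a \<delta>" by (auto simp: V_def)
      moreover have "w a \<delta> \<le> w a (\<gamma> + \<delta>)"
        unfolding w_def by (intro sum_mono div_le_mono) simp
      ultimately show ?thesis by simp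
    qed
    then show "r * x \<in> V" by (simp add: V_def)
  qed (simp add: V_def translate_0)
  with \<open>f \<in> power_ideal t g\<close> have "f \<in> V" by (auto simp: power_ideal_def)
  show ?thesis
    unfolding vanishes_def
  proof (intro ballI allI impI, rule ccontr)
    fix a \<beta>
    assume "a \<in> Pi UNIV S" "int (\<Sum>i\<in>UNIV. \<beta> $ i div \<psi> i (a i)) \<le> int t - 1"
      and "Poly_Mapping.lookup (translate a f) \<beta> \<noteq> 0"
    with \<open>f \<in> V\<close> have "t \<le> w a \<beta>" "int (w a \<beta>) \<le> int t - 1"
      by (auto simp: V_def in_keys_iff w_def)
    then show False by simp
  qed
qed

section \<open>Maximal exponents of the support\<close>

text \<open>Write \<open>\<beta>\<close> as an exponent of \<open>p \<alpha>\<close> plus one of the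
  power product, and replace the latter by the leading exponent \<open>\<eta>\<close>. The result
  lies above \<open>\<beta>\<close> and, by the support inclusion, below some exponent of
  \<open>f\<close>; maximality of \<open>\<beta>\<close> forces equality.\<close>

lemma max_elements_bound:
  fixes S :: "'n::finite \<Rightarrow> 'a::comm_ring_1 set"
  assumes fin: "\<And>k. finite (S k)"
    and G: "\<And>k. G k = (\<Prod>u\<in>S k. [:- u, 1:] ^ \<psi> k u)"
    and g: "\<And>k. g k = univariate k (G k)"
    and f: "f = (\<Sum>\<alpha> | total \<alpha> = t. p \<alpha> * gpower g \<alpha>)"
    and keys: "\<And>\<alpha>. total \<alpha> = t \<Longrightarrow> Poly_Mapping.keys (p \<alpha>) + Poly_Mapping.keys (gpower g \<alpha>)
      \<subseteq> down_closure (Poly_Mapping.keys f)"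
    and \<beta>: "\<beta> \<in> max_elements (Poly_Mapping.keys f)"
  shows "\<exists>\<gamma>. total \<gamma> = t \<and> (\<forall>k. (\<Sum>u\<in>S k. \<psi> k u) * \<gamma> $ k \<le> \<beta> $ k)"
proof -
  define d where "d k = (\<Sum>u\<in>S k. \<psi> k u)" for k
  have monic: "lead_coeff (G k) = 1" for k
    unfolding G by (rule monic_node_poly [OF fin])
  have degree_G: "Polynomial.degree (G k ^ m) = d k * m" for k m
    unfolding monic_power(1) [OF monic] unfolding G monic_node_poly [OF fin] d_def ..
  have coeff_G: "coeff (G k ^ m) (d k * m) = 1" for k m
    using monic_power(2) [OF monic, of k m] unfolding degree_G .
  have "\<beta> \<in> Poly_Mapping.keys f" using \<beta> by (simp add: max_elements_def)
  then have "\<beta> \<in> (\<Union>\<alpha>\<in>{\<alpha>. total \<alpha> = t}. Poly_Mapping.keys (p \<alpha> * gpower g \<alpha>))"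
    unfolding f by (rule subsetD [OF keys_sum])
  then obtain \<alpha> where \<alpha>: "total \<alpha> = t" and "\<beta> \<in> Poly_Mapping.keys (p \<alpha> * gpower g \<alpha>)"
    by auto
  with keys_mult obtain \<delta> \<epsilon> where \<beta>_eq: "\<beta> = \<delta> + \<epsilon>" and \<delta>: "\<delta> \<in> Poly_Mapping.keys (p \<alpha>)"
    and \<epsilon>: "\<epsilon> \<in> Poly_Mapping.keys (gpower g \<alpha>)"
    by fastforce
  define \<eta> :: "nat ^ 'n" where "\<eta> = (\<chi> k. d k * \<alpha> $ k)"
  have "\<epsilon> $ k \<le> \<eta> $ k" for k
    using keys_tensor [OF \<epsilon> [unfolded gpower_tensor [OF g]], of k] by (simp add: \<eta>_def degree_G)
  then have "\<beta> \<le> \<delta> + \<eta>" by (simp add: \<beta>_eq less_eq_vec_def)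
  \<comment> \<open>The coefficient there is a product of leading coefficients of monic polynomials,
    namely 1.\<close>
  have "\<eta> \<in> Poly_Mapping.keys (gpower g \<alpha>)"
    by (simp add: in_keys_iff gpower_tensor [OF g] lookup_tensor \<eta>_def coeff_G)
  with \<delta> have "\<delta> + \<eta> \<in> Poly_Mapping.keys (p \<alpha>) + Poly_Mapping.keys (gpower g \<alpha>)"
    by (rule set_plus_intro)
  with keys [OF \<alpha>] obtain \<beta>' where "\<beta>' \<in> Poly_Mapping.keys f" "\<delta> + \<eta> \<le> \<beta>'"
    by (auto simp: down_closure_def)
  with \<beta> \<open>\<beta> \<le> \<delta> + \<eta>\<close> have "\<delta> + \<eta> \<le> \<beta>"
    unfolding max_elements_def by (metis (mono_tags, lifting) mem_Collect_eq order_trans)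
  then have "d k * \<alpha> $ k \<le> \<beta> $ k" for k
    by (simp add: less_eq_vec_def \<eta>_def) (meson add_leE)
  with \<alpha> show ?thesis unfolding d_def by blast
qed

section \<open>Necessity of Condition (D)\<close>

interpretation const_poly: coefficient_hom "\<lambda>x :: 'a::comm_ring_1. [:x:]"
  by standard (simp_all add: one_pCons)

lemma pcompose_const_right: "pcompose p [:x:] = [:poly p x:]"
  for x :: "'a::comm_ring_1"
  by (induction p) (simp_all add: pcompose_pCons)

lemma const_poly_eval_univariate:
  "const_poly.eval q (univariate k p) = pcompose p (q k)"
  by (induction p)
    (simp_all add: univariate_pCons const_poly.eval_0 const_poly.eval_add const_poly.eval_mult
      const_poly.eval_Const const_poly.eval_Var pcompose_pCons)

text \<open>Evaluating each variable other than \<open>k\<close> at \<open>a\<close> kills every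
  \<open>g i\<close> with \<open>i \<noteq> k\<close>, because \<open>a i\<close> is a root of
  \<open>G i\<close>. Among the generators only the \<open>t\<close>-th power of \<open>g k\<close>
  can survive, and it becomes \<open>G k ^ t\<close>.\<close>

lemma power_ideal_univariate_dvd:
  fixes S :: "'n::finite \<Rightarrow> 'a::comm_ring_1 set"
  assumes fin: "\<And>k. finite (S k)"
    and pos: "\<And>k u. u \<in> S k \<Longrightarrow> \<psi> k u > 0"
    and G: "\<And>k. G k = (\<Prod>u\<in>S k. [:- u, 1:] ^ \<psi> k u)"
    and g: "\<And>k. g k = univariate k (G k)"
    and a: "a \<in> Pi UNIV S"
    and "univariate k p \<in> power_ideal t g"
  shows "G k ^ t dvd p"
proof -
  define q where "q i = (if i = k then [:0, 1:] else [:a i:])" for i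
  define V where "V = {f. G k ^ t dvd const_poly.eval q f}"
  have "generated_ideal {gpower g \<alpha> | \<alpha>. total \<alpha> = t} \<subseteq> V"
  proof (rule generated_ideal_minimal)
    show "{gpower g \<alpha> | \<alpha>. total \<alpha> = t} \<subseteq> V"
    proof safe
      fix \<alpha> :: "nat ^ 'n" assume t: "t = total \<alpha>"
      have ev: "const_poly.eval q (gpower g \<alpha>) = (\<Prod>i\<in>UNIV. pcompose (G i) (q i) ^ (\<alpha> $ i))"
        by (simp add: gpower_def const_poly.eval_prod const_poly.eval_power g
            const_poly_eval_univariate)
      show "gpower g \<alpha> \<in> V"
      proof (cases "\<exists>i. i \<noteq> k \<and> \<alpha> $ i > 0")
        case True
        then obtain i where i: "i \<noteq> k" "\<alpha> $ i > 0" by blast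
        have "poly (G i) (a i) = 0"
          unfolding G poly_prod poly_power using fin a pos
          by (intro prod_zero) (auto intro!: bexI [of _ "a i"] simp: Pi_iff zero_power)
        moreover have "pcompose (G i) (q i) = [:poly (G i) (a i):]"
          using i by (simp add: q_def pcompose_const_right)
        ultimately have "pcompose (G i) (q i) ^ (\<alpha> $ i) = 0"
          using i by (simp add: zero_power)
        then have "const_poly.eval q (gpower g \<alpha>) = 0"
          unfolding ev by (intro prod_zero) auto
        then show ?thesis by (simp add: V_def)
      next
        case False
        have "t = (\<Sum>i\<in>UNIV. if i = k then \<alpha> $ i else 0)"
          unfolding t total_def using False by (intro sum.cong) auto
        then have "t = \<alpha> $ k" by simp
        then have "G k ^ t = pcompose (G k) (q k) ^ (\<alpha> $ k)"
          by (simp add: q_def)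
        also have "\<dots> dvd const_poly.eval q (gpower g \<alpha>)"
          unfolding ev by (rule dvd_prodI) auto
        finally show ?thesis by (simp add: V_def)
      qed
    qed
  qed (auto simp: V_def const_poly.eval_0 const_poly.eval_add const_poly.eval_mult)
  with assms(6) have "G k ^ t dvd const_poly.eval q (univariate k p)"
    unfolding power_ideal_def V_def by blast
  then show ?thesis by (simp add: const_poly_eval_univariate q_def)
qed

lemma condition_D_necessary:
  fixes S :: "'n::finite \<Rightarrow> 'a::comm_ring_1 set"
  assumes fin: "\<And>k. finite (S k)"
    and pos: "\<And>k u. u \<in> S k \<Longrightarrow> \<psi> k u > 0"
    and G: "\<And>k. G k = (\<Prod>u\<in>S k. [:- u, 1:] ^ \<psi> k u)"
    and g: "\<And>k. g k = univariate k (G k)"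
    and ne: "Pi UNIV S \<noteq> {}"
    and t: "t > 0"
    and all: "\<And>f. vanishes S \<psi> t f \<Longrightarrow> f \<in> power_ideal t g"
  shows "condition_D (S k)"
  unfolding condition_D_def
proof (intro ballI impI notI)
  fix a b assume ab: "a \<in> S k" "b \<in> S k" "a \<noteq> b" and "zero_divisor (b - a)"
  then obtain s where s: "s \<noteq> 0" "(b - a) * s = 0" by (auto simp: zero_divisor_def)
  define L where "L = [:- b, 1:] ^ (\<psi> k b - 1)"
  define P where "P T = (\<Prod>u\<in>T. [:- u, 1:] ^ \<psi> k u)" for T
  \<comment> \<open>\<open>H\<close> is \<open>G k\<close> with one factor x - b removed; positivity
    of \<open>\<psi> k b\<close> makes the exponent in \<open>L\<close> correct.\<close>
  define H where "H = L * P (S k - {b})"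
  have power_b: "[:- b, 1:] ^ \<psi> k b = [:- b, 1:] * L"
    using pos [OF ab(2)] unfolding L_def by (metis power_eq_if less_not_refl2)
  have "G k = [:- b, 1:] ^ \<psi> k b * P (S k - {b})"
    unfolding G P_def by (rule prod.remove [OF fin ab(2)])
  then have GH: "G k = [:- b, 1:] * H"
    by (simp only: power_b H_def mult.assoc)
  \<comment> \<open>One factor x - b is missing from \<open>G k ^ t\<close>, yet after scaling by
    \<open>s\<close> every required power of x - u still divides, since \<open>s\<close> cannot tell
    x - a from x - b.\<close>
  define F where "F = smult s (H * G k ^ (t - 1))"
  have dvd: "[:- u, 1:] ^ (\<psi> k u * t) dvd F" if u: "u \<in> S k" for u
  proof -
    have "[:- u, 1:] ^ \<psi> k u dvd smult s H"
    proof (cases "u = b")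
      case False
      then have "[:- u, 1:] ^ \<psi> k u dvd P (S k - {b})"
        unfolding P_def using fin u by (intro linear_power_dvd_node_poly) auto
      then show ?thesis unfolding H_def by (intro dvd_smult dvd_mult)
    next
      case True
      have "[:- a, 1:] dvd P (S k - {b})"
      proof -
        have "[:- a, 1:] dvd [:- a, 1:] ^ \<psi> k a" using pos [OF ab(1)] by (intro dvd_power) simp
        also have "\<dots> dvd P (S k - {b})"
          unfolding P_def using fin ab by (intro linear_power_dvd_node_poly) auto
        finally show ?thesis .
      qed
      then obtain Q where Q: "P (S k - {b}) = [:- a, 1:] * Q" by (rule dvdE)
      \<comment> \<open>Multiplied by \<open>s\<close>, the factor \<open>x - a\<close> supplies the missing factor \<open>x - b\<close>.\<close>
      have "smult s [:- a, 1:] = smult s [:- b, 1:]"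
        using s by (simp add: algebra_simps)
      have "smult s H = smult s [:- a, 1:] * (L * Q)"
        by (simp only: H_def Q mult_smult_left mult.left_commute [of L])
      also have "\<dots> = smult s ([:- b, 1:] ^ \<psi> k b * Q)"
        by (simp only: \<open>smult s [:- a, 1:] = smult s [:- b, 1:]\<close> power_b mult_smult_left mult.assoc)
      finally show ?thesis using True by (simp add: dvd_smult)
    qed
    moreover have "[:- u, 1:] ^ (\<psi> k u * (t - 1)) dvd G k ^ (t - 1)"
      unfolding power_mult G using fin u
      by (intro dvd_power_same linear_power_dvd_node_poly) auto
    ultimately have "[:- u, 1:] ^ \<psi> k u * [:- u, 1:] ^ (\<psi> k u * (t - 1)) dvd smult s H * G k ^ (t - 1)"
      by (rule mult_dvd_mono)
    moreover have "\<psi> k u * t = \<psi> k u + \<psi> k u * (t - 1)"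
      using t by (cases t) auto
    ultimately show ?thesis by (simp add: F_def power_add)
  qed
  have "vanishes S \<psi> t (univariate k F)"
    unfolding vanishes_def
  proof (intro ballI allI impI)
    fix c \<beta>
    assume c: "c \<in> Pi UNIV S" and "int (\<Sum>i\<in>UNIV. \<beta> $ i div \<psi> i (c i)) \<le> int t - 1"
    \<comment> \<open>The bound on the whole sum bounds its \<open>k\<close>-th floor, which puts
      \<open>\<beta> $ k\<close> below the exponent of the dividing power.\<close>
    then have "(\<Sum>i\<in>UNIV. \<beta> $ i div \<psi> i (c i)) < t" by linarith
    moreover have "\<beta> $ k div \<psi> k (c k) \<le> (\<Sum>i\<in>UNIV. \<beta> $ i div \<psi> i (c i))"
      by (rule member_le_sum) auto
    ultimately have "\<beta> $ k div \<psi> k (c k) < t" by linarith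
    moreover have "c k \<in> S k" using c by auto
    ultimately have "\<beta> $ k < \<psi> k (c k) * t"
      using pos by (simp add: div_less_iff_less_mult mult.commute)
    with dvd [OF \<open>c k \<in> S k\<close>] have 0: "coeff (pcompose F [:c k, 1:]) (\<beta> $ k) = 0"
      by (rule dvd_imp_coeff_pcompose_eq_0)
    have "univariate k F = tensor (\<lambda>i. if i = k then F else 1)"
    proof -
      have "tensor (\<lambda>i. if i = k then F else 1) = (\<Prod>i\<in>UNIV. if i = k then univariate i F else 1)"
        unfolding tensor_def by (intro prod.cong) auto
      then show ?thesis by simp
    qed
    then show "Poly_Mapping.lookup (translate c (univariate k F)) \<beta> = 0"
      using 0 by (auto simp: translate_tensor lookup_tensor intro!: prod_zero)
  qed
  then have "univariate k F \<in> power_ideal t g" by (rule all)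
  then have "G k ^ t dvd F"
    using ne power_ideal_univariate_dvd [OF fin pos G g] by blast
  then obtain Q where Q: "F = G k ^ t * Q" by (rule dvdE)
  \<comment> \<open>\<open>F\<close> is \<open>s\<close> times \<open>M\<close>, and
    \<open>M\<close> turns out to be monic of degree one less than \<open>G k ^ t\<close>. So
    \<open>F\<close> is nonzero of too small a degree to be a multiple of
    \<open>G k ^ t\<close>.\<close>
  define M where "M = H * G k ^ (t - 1)"
  have monic: "lead_coeff (G k ^ t) = 1"
    unfolding G by (intro monic_power monic_node_poly fin)
  have GM: "G k ^ t = [:- b, 1:] * M"
    using t by (cases t) (simp_all only: GH M_def power_Suc mult.assoc diff_Suc_1)
  then have "coeff (G k ^ t) (Suc (Polynomial.degree M)) = lead_coeff M"
    by (simp add: coeff_eq_0)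
  moreover have "M \<noteq> 0" using monic GM by auto
  ultimately have "Suc (Polynomial.degree M) \<le> Polynomial.degree (G k ^ t)"
    by (intro le_degree) simp
  moreover have "Polynomial.degree (G k ^ t) \<le> Suc (Polynomial.degree M)"
    using degree_mult_le [of "[:- b, 1:]" M] by (simp add: GM)
  ultimately have deg: "Polynomial.degree (G k ^ t) = Suc (Polynomial.degree M)"
    by simp
  with \<open>coeff (G k ^ t) (Suc (Polynomial.degree M)) = lead_coeff M\<close> monic
  have "coeff F (Polynomial.degree M) = s"
    by (simp add: F_def M_def)
  with s have "Q \<noteq> 0" by (auto simp: Q)
  \<comment> \<open>Since \<open>G k ^ t\<close> is monic, the leading coefficient of
    \<open>Q\<close> survives in the product even in the presence of zero divisors.\<close>
  have "coeff F (Polynomial.degree (G k ^ t) + Polynomial.degree Q) = lead_coeff Q"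
    unfolding Q coeff_mult_degree_sum monic by simp
  with \<open>Q \<noteq> 0\<close> have "Polynomial.degree (G k ^ t) \<le> Polynomial.degree F"
    by (metis le_degree le_add1 le_trans leading_coeff_0_iff)
  moreover have "Polynomial.degree F \<le> Polynomial.degree M"
    unfolding F_def M_def by (rule degree_smult_le)
  ultimately show False using deg by simp
qed

theorem theorem5p2:
  fixes S :: "'n::finite \<Rightarrow> 'a::comm_ring_1 set"
    and \<psi> :: "'n \<Rightarrow> 'a \<Rightarrow> nat"
    and g :: "'n \<Rightarrow> ('n, 'a) mpoly"
  assumes fin: "\<And>k. finite (S k)"
    and pos: "\<And>k u. u \<in> S k \<Longrightarrow> \<psi> k u > 0"
    and g: "\<And>k. g k = (\<Prod>u\<in>S k. (Var k - Const u) ^ \<psi> k u)"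
  shows
    "((\<forall>k. condition_D (S k)) \<longrightarrow>
        (\<forall>t f. f \<in> power_ideal t g \<longleftrightarrow> vanishes S \<psi> t f))
     \<and>
     ((\<forall>k. condition_D (S k)) \<longrightarrow>
        (\<forall>t f. vanishes S \<psi> t f \<longrightarrow>
          (\<exists>p :: nat ^ 'n \<Rightarrow> ('n, 'a) mpoly.
             f = (\<Sum>\<alpha> | total \<alpha> = t. p \<alpha> * gpower g \<alpha>) \<and>
             (\<forall>\<alpha>. total \<alpha> = t \<longrightarrow>
                Poly_Mapping.keys (p \<alpha>) + Poly_Mapping.keys (gpower g \<alpha>)
                  \<subseteq> down_closure (Poly_Mapping.keys f))) \<and>
          (\<forall>\<beta>\<in>max_elements (Poly_Mapping.keys f).
             \<exists>\<gamma>. total \<gamma> = t \<and> (\<forall>k. (\<Sum>u\<in>S k. \<psi> k u) * \<gamma> $ k \<le> \<beta> $ k))))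
     \<and>
     (Pi UNIV S \<noteq> {} \<longrightarrow>
        (\<forall>t>0. (\<forall>f. vanishes S \<psi> t f \<longrightarrow> f \<in> power_ideal t g) \<longrightarrow>
          (\<forall>k. condition_D (S k))))"
proof -
  \<comment> \<open>Degrees and divisibility are handled for this polynomial in one variable;
    \<open>g k\<close> is its image under \<open>univariate k\<close>.\<close>
  define G where "G k = (\<Prod>u\<in>S k. [:- u, 1:] ^ \<psi> k u)" for k
  have gG: "g k = univariate k (G k)" for k
    unfolding g G_def by (rule univariate_node_poly)
  have sufficient: "f \<in> power_ideal t g" if "\<forall>k. condition_D (S k)" "vanishes S \<psi> t f" for t f
  proof -
    from that vanishes_representation [OF fin pos G_def gG]
    obtain p where "f = (\<Sum>\<alpha> | total \<alpha> = t. p \<alpha> * gpower g \<alpha>)" by blast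
    then show ?thesis
      unfolding power_ideal_def by (auto intro!: generated_ideal_sum)
  qed
  show ?thesis
  proof (intro conjI impI allI iffI ballI)
    fix t f
    assume D: "\<forall>k. condition_D (S k)"
    show "f \<in> power_ideal t g" if "vanishes S \<psi> t f"
      using D that by (rule sufficient)
    show "vanishes S \<psi> t f" if "f \<in> power_ideal t g"
      using fin pos G_def gG that by (rule power_ideal_vanishes)
    assume van: "vanishes S \<psi> t f"
    show ex: "\<exists>p. f = (\<Sum>\<alpha> | total \<alpha> = t. p \<alpha> * gpower g \<alpha>) \<and>
        (\<forall>\<alpha>. total \<alpha> = t \<longrightarrow>
          Poly_Mapping.keys (p \<alpha>) + Poly_Mapping.keys (gpower g \<alpha>)
            \<subseteq> down_closure (Poly_Mapping.keys f))"
      using fin pos G_def gG D [rule_format] van by (rule vanishes_representation)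
    fix \<beta> assume \<beta>: "\<beta> \<in> max_elements (Poly_Mapping.keys f)"
    from ex obtain p where "f = (\<Sum>\<alpha> | total \<alpha> = t. p \<alpha> * gpower g \<alpha>)"
      and "\<And>\<alpha>. total \<alpha> = t \<Longrightarrow> Poly_Mapping.keys (p \<alpha>) + Poly_Mapping.keys (gpower g \<alpha>)
        \<subseteq> down_closure (Poly_Mapping.keys f)" by blast
    then show "\<exists>\<gamma>. total \<gamma> = t \<and> (\<forall>k. (\<Sum>u\<in>S k. \<psi> k u) * \<gamma> $ k \<le> \<beta> $ k)"
      using \<beta> by (rule max_elements_bound [OF fin G_def gG])
  next
    fix t :: nat and k
    assume "Pi UNIV S \<noteq> {}" "t > 0" "\<forall>f. vanishes S \<psi> t f \<longrightarrow> f \<in> power_ideal t g"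
    then show "condition_D (S k)"
      by (intro condition_D_necessary [OF fin pos G_def gG]) auto
  qed
qed

end
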